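(* Let $\varepsilon\in(0,1)$ be a fixed constant and let $G=G(n,p)$ be the binomial random graph with $p\gg n^{-\varepsilon}$. Then asymptotically almost surely $\chi'_{\rm pOCF}(G)\le\Delta(G)+O(\ln\Delta(G))=(1+o(1))\Delta(G)$.
   Context: $\Delta(G)$ denotes the maximum degree of $G$. For an edge colouring $c:E\to\mathbb{N}$ of $G=(V,E)$ and an edge $uv$, the open neighbourhood is $E_G(uv)=(E_G(u)\cup E_G(v))\setminus\{uv\}$, where $E_G(x)$ is the set of edges incident with $x$; $uv$ is satisfied if some colour appears on exactly one edge of $E_G(uv)$. The colouring is open conflict-free if every non-isolated edge is satisfied. $\chi'_{\rm pOCF}(G)$ is the minimum number of colours of a proper (adjacent edges get distinct colours) open conflict-free edge colouring of $G$. "Asymptotically almost surely" means with probability tending to $1$ as $n\to\infty$. *)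

theory Defs
  imports "HOL-Probability.Product_PMF" "HOL-Library.Ramsey" "HOL-Library.Landau_Symbols"
begin

text \<open>A finite simple graph is given by its vertex set \<open>V\<close> and its edge set \<open>E\<close>, a set of
  two-element subsets of \<open>V\<close>.\<close>

definition incident_edges :: "'a set set \<Rightarrow> 'a \<Rightarrow> 'a set set" where
  "incident_edges E x = {e \<in> E. x \<in> e}"

definition degree :: "'a set set \<Rightarrow> 'a \<Rightarrow> nat" where
  "degree E x = card (incident_edges E x)"

text \<open>Unspecified for the graph without vertices.\<close>

definition max_degree :: "'a set \<Rightarrow> 'a set set \<Rightarrow> nat" where
  "max_degree V E = Max (degree E ` V)"

definition open_nbhd :: "'a set set \<Rightarrow> 'a set \<Rightarrow> 'a set set" where
  "open_nbhd E e = (\<Union>x\<in>e. incident_edges E x) - {e}"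

definition isolated_edge :: "'a set set \<Rightarrow> 'a set \<Rightarrow> bool" where
  "isolated_edge E e \<longleftrightarrow> open_nbhd E e = {}"

definition satisfied :: "'a set set \<Rightarrow> ('a set \<Rightarrow> nat) \<Rightarrow> 'a set \<Rightarrow> bool" where
  "satisfied E c e \<longleftrightarrow> (\<exists>k. \<exists>!f. f \<in> open_nbhd E e \<and> c f = k)"

definition open_conflict_free :: "'a set set \<Rightarrow> ('a set \<Rightarrow> nat) \<Rightarrow> bool" where
  "open_conflict_free E c \<longleftrightarrow> (\<forall>e\<in>E. \<not> isolated_edge E e \<longrightarrow> satisfied E c e)"

definition proper_edge_colouring :: "'a set set \<Rightarrow> ('a set \<Rightarrow> nat) \<Rightarrow> bool" where
  "proper_edge_colouring E c \<longleftrightarrow>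
     (\<forall>e\<in>E. \<forall>f\<in>E. e \<noteq> f \<and> e \<inter> f \<noteq> {} \<longrightarrow> c e \<noteq> c f)"

text \<open>The minimum exists for every finite \<open>E\<close>: any colouring that is injective on \<open>E\<close> is proper
  and open conflict-free.\<close>

definition chi_pOCF :: "'a set set \<Rightarrow> nat" where
  "chi_pOCF E = (LEAST k. \<exists>c. proper_edge_colouring E c \<and> open_conflict_free E c \<and> card (c ` E) = k)"

text \<open>The edge set of $G(n,p)$ on the vertex set \<open>{..<n}\<close>: each two-element subset is an edge
  independently with probability \<open>p\<close>, for \<open>0 \<le> p \<le> 1\<close>.\<close>

definition binomial_random_graph :: "nat \<Rightarrow> real \<Rightarrow> nat set set pmf" where
  "binomial_random_graph n p =
     map_pmf (\<lambda>f. {e \<in> nsets {..<n} 2. f e})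
       (Pi_pmf (nsets {..<n} 2) False (\<lambda>_. bernoulli_pmf p))"

definition asymptotically_almost_surely ::
    "(nat \<Rightarrow> 'b pmf) \<Rightarrow> (nat \<Rightarrow> 'b \<Rightarrow> bool) \<Rightarrow> bool" where
  "asymptotically_almost_surely M P \<longleftrightarrow>
     (\<lambda>n. measure_pmf.prob (M n) {x. P n x}) \<longlonglongrightarrow> 1"

end

theory Submission
  imports Defs "HOL-Real_Asymp.Real_Asymp"
begin

text \<open>A few matchings separate all edges. If a matching \<open>M\<close> covers exactly one endpoint of the edge
  \<open>e\<close>, and \<open>M\<close> is a colour class, then \<open>e\<close> is satisfied by the colour of \<open>M\<close>. In a graph whose degrees
  differ by at most a constant factor, let every vertex independently select a neighbour and decide
  whether it is a sender; keeping the selections that form a matching covers exactly one endpoint of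
  any given pair with probability at least a constant \<open>\<kappa> > 0\<close>. Hence some matching serves a proportion
  \<open>\<kappa>\<close> of the edges that are still unsatisfied. Removing it lowers each degree by at most one, so the step
  can be repeated, and \<open>L = O(ln n)\<close> disjoint matchings serve every edge. They receive private colours,
  and by Vizing's theorem the remaining edges need at most \<open>\<Delta> + 1\<close> further colours. In the random graph
  all degrees lie between \<open>m / 4\<close> and \<open>3 m\<close> with \<open>m = (n - 1) p\<close> by exponential moments, and
  \<open>ln n = O(ln \<Delta>)\<close> because \<open>p\<close> is at least a power of \<open>n\<close>.\<close>

section \<open>Vizing's theorem\<close>

lemma mem_incident_edges [simp]: "e \<in> incident_edges E x \<longleftrightarrow> e \<in> E \<and> x \<in> e"
  by (simp add: incident_edges_def)

lemma proper_unique: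
  assumes "proper_edge_colouring E c" "e \<in> E" "f \<in> E" "x \<in> e" "x \<in> f" "c e = c f"
  shows "e = f"
  using assms unfolding proper_edge_colouring_def by blast

section \<open>Missing colours and Vizing fans\<close>

definition colours_at :: "'a set set \<Rightarrow> ('a set \<Rightarrow> 'c) \<Rightarrow> 'a \<Rightarrow> 'c set" where
  "colours_at E c x = c ` incident_edges E x"

text \<open>\<open>F\<close> is the part coloured so far. The head is the other end of an uncoloured
  edge at \<open>x\<close>, and each later edge has a colour free at the preceding vertex, so
  colours can move one place towards the head.\<close>

definition fan :: "'a set set \<Rightarrow> ('a set \<Rightarrow> nat) \<Rightarrow> 'a \<Rightarrow> 'a list \<Rightarrow> bool" where
  "fan F c x ys \<longleftrightarrow> ys \<noteq> [] \<and> distinct ys \<and> x \<notin> set ys \<and> {x, hd ys} \<notin> F \<and>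
     (\<forall>i. Suc i < length ys \<longrightarrow>
        {x, ys ! Suc i} \<in> F \<and> c {x, ys ! Suc i} \<notin> colours_at F c (ys ! i))"

text \<open>Rotating the fan passes the uncoloured edge from the head to the last vertex, where
  \<beta> is free at both ends. \<open>F\<close> and \<open>c\<close> vary in the induction because
  the uncoloured edge moves.\<close>

lemma fan_shift:
  assumes "proper_edge_colouring F c" "fan F c x ys" "\<beta> \<notin> colours_at F c x"
    "\<beta> \<notin> colours_at F c (last ys)"
  shows "\<exists>c'. proper_edge_colouring (insert {x, hd ys} F) c' \<and>
           c' ` insert {x, hd ys} F \<subseteq> insert \<beta> (c ` F)"
  using assms
proof (induction ys arbitrary: F c)
  case Nil
  then show ?case by (simp add: fan_def)
next
  case (Cons y ys)
  show ?case
  proof (cases ys)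
    case Nil
    have nF: "{x, y} \<notin> F" using Cons.prems(2) by (simp add: fan_def)
    let ?c = "c({x, y} := \<beta>)"
    have b: "c f \<noteq> \<beta>" if "f \<in> F" "f \<inter> {x, y} \<noteq> {}" for f
      using that Cons.prems(3,4) Nil by (auto simp: colours_at_def)
    have "proper_edge_colouring (insert {x, y} F) ?c"
      unfolding proper_edge_colouring_def
    proof (intro ballI impI)
      fix e f assume ef: "e \<in> insert {x, y} F" "f \<in> insert {x, y} F" "e \<noteq> f \<and> e \<inter> f \<noteq> {}"
      show "?c e \<noteq> ?c f"
      proof (cases "e = {x, y} \<or> f = {x, y}")
        case True
        with ef have "e \<in> F \<and> f = {x,y} \<or> f \<in> F \<and> e = {x,y}" by blast
        with ef b[of e] b[of f] show ?thesis by (auto simp: Int_commute)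
      next
        case False
        with ef Cons.prems(1) show ?thesis by (auto simp: proper_edge_colouring_def)
      qed
    qed
    then show ?thesis unfolding Nil by (intro exI[of _ ?c] conjI) (auto simp: fun_upd_def)
  next
    case (Cons z zs)
    \<comment> \<open>One rotation: \<open>{x, y}\<close> takes the colour of \<open>{x, z}\<close>,
      which becomes the uncoloured edge.\<close>
    let ?F = "insert {x, y} (F - {{x, z}})"
    let ?c = "c({x, y} := c {x, z})"
    have fn: "fan F c x (y # ys)" by fact
    have xy: "x \<noteq> y" "{x, y} \<notin> F" "x \<noteq> z" "y \<noteq> z" using fn Cons by (auto simp: fan_def)
    have step: "{x, (y # ys) ! Suc i} \<in> F"
        "c {x, (y # ys) ! Suc i} \<notin> colours_at F c ((y # ys) ! i)"
      if "Suc i < length (y # ys)" for i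
      using fn that unfolding fan_def by blast+
    have xz: "{x, z} \<in> F" "c {x, z} \<notin> colours_at F c y"
      using step[of 0] Cons by auto
    have proper': "proper_edge_colouring ?F ?c"
      unfolding proper_edge_colouring_def
    proof (intro ballI impI)
      fix e f assume ef: "e \<in> ?F" "f \<in> ?F" "e \<noteq> f \<and> e \<inter> f \<noteq> {}"
      have b: "c g \<noteq> c {x, z}" if "g \<in> F - {{x, z}}" "g \<inter> {x, y} \<noteq> {}" for g
      proof -
        have "c g \<noteq> c {x, z}" if "x \<in> g"
          using proper_unique[OF Cons.prems(1), of g "{x,z}" x] \<open>g \<in> F - {{x, z}}\<close> xz that by auto
        moreover have "c g \<noteq> c {x, z}" if "y \<in> g"
          proof -
          have "c g \<in> colours_at F c y"
            using \<open>g \<in> F - {{x, z}}\<close> that by (auto simp: colours_at_def)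
          then show ?thesis using xz(2) by auto
        qed
        ultimately show ?thesis using that(2) by auto
      qed
      show "?c e \<noteq> ?c f"
      proof (cases "e = {x, y} \<or> f = {x, y}")
        case True
        with ef have "e \<in> F - {{x, z}} \<and> f = {x,y} \<or> f \<in> F - {{x, z}} \<and> e = {x,y}" by blast
        then show ?thesis
        proof (elim disjE conjE)
          assume *: "e \<in> F - {{x, z}}" "f = {x, y}"
          then have "c e \<noteq> c {x, z}" using b[of e] ef by blast
          then show ?thesis using * ef by simp
        next
          assume *: "f \<in> F - {{x, z}}" "e = {x, y}"
          then have "c f \<noteq> c {x, z}" using b[of f] ef by blast
          then show ?thesis using * ef by auto
        qed
      next
        case False
        with ef Cons.prems(1) show ?thesis by (auto simp: proper_edge_colouring_def)
      qed
    qed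
    \<comment> \<open>No vertex except \<open>y\<close> gains a colour, so what is free elsewhere
      stays free.\<close>
    have sub: "colours_at ?F ?c v \<subseteq> colours_at F c v" if "v \<noteq> x" "v \<noteq> y" for v
      using that xy by (auto simp: colours_at_def)
    have subx: "colours_at ?F ?c x \<subseteq> colours_at F c x"
      using xz by (auto simp: colours_at_def)
    have fan': "fan ?F ?c x ys"
      unfolding fan_def
    proof (intro conjI allI impI)
      show "ys \<noteq> []" "distinct ys" "x \<notin> set ys" using fn Cons by (auto simp: fan_def)
      show "{x, hd ys} \<notin> ?F" using xy Cons by (auto simp: doubleton_eq_iff)
    next
      fix i assume i: "Suc i < length ys"
      have neq: "ys ! Suc i \<noteq> y" "ys ! Suc i \<noteq> z" "ys ! i \<noteq> x" "ys ! i \<noteq> y"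
      proof -
        have "distinct ys" "y \<notin> set ys" "x \<notin> set ys" using fn by (auto simp: fan_def)
        then show "ys ! Suc i \<noteq> y" "ys ! i \<noteq> x" "ys ! i \<noteq> y"
          using i by (metis nth_mem, metis nth_mem Suc_lessD, metis nth_mem Suc_lessD)
        have "ys ! Suc i \<noteq> ys ! 0" using \<open>distinct ys\<close> i by (subst nth_eq_iff_index_eq) auto
        then show "ys ! Suc i \<noteq> z" using Cons by simp
      qed
      show "{x, ys ! Suc i} \<in> ?F"
        using step(1)[of "Suc i"] i neq by (auto simp: doubleton_eq_iff)
      have "c {x, ys ! Suc i} \<notin> colours_at F c (ys ! i)"
        using step(2)[of "Suc i"] i by simp
      then show "?c {x, ys ! Suc i} \<notin> colours_at ?F ?c (ys ! i)"
        using sub[OF neq(3,4)] neq xy by (auto simp: doubleton_eq_iff)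
    qed
    have last: "last ys \<noteq> x" "last ys \<noteq> y" "last (y # ys) = last ys"
      using fn Cons unfolding fan_def by (metis last_in_set list.distinct(1) list.set_intros(2)
        distinct.simps(2) last_ConsR)+
    have "\<beta> \<notin> colours_at ?F ?c x" "\<beta> \<notin> colours_at ?F ?c (last ys)"
      using subx sub[OF last(1,2)] Cons.prems(3,4) unfolding last(3) by blast+
    from Cons.IH[OF proper' fan' this] obtain c' where c':
      "proper_edge_colouring (insert {x, hd ys} ?F) c'"
      "c' ` insert {x, hd ys} ?F \<subseteq> insert \<beta> (?c ` ?F)" by blast
    have eq: "insert {x, hd ys} ?F = insert {x, y} F" using xz Cons by auto
    have "?c ` ?F \<subseteq> c ` F" using xz by auto
    then have "insert \<beta> (?c ` ?F) \<subseteq> insert \<beta> (c ` F)" by (rule insert_mono)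
    then show ?thesis using c'(1) subset_trans[OF c'(2)] unfolding eq list.sel by blast
  qed
qed

section \<open>Kempe chains\<close>

definition kempe_closed :: "'a set set \<Rightarrow> ('a set \<Rightarrow> nat) \<Rightarrow> nat \<Rightarrow> nat \<Rightarrow> 'a set \<Rightarrow> bool" where
  "kempe_closed F c \<alpha> \<beta> K \<longleftrightarrow>
     (\<forall>e\<in>F. c e \<in> {\<alpha>, \<beta>} \<longrightarrow> e \<inter> K \<noteq> {} \<longrightarrow> e \<subseteq> K)"

text \<open>For a closed \<open>K\<close>, an edge of colour \<alpha> or \<beta> that meets
  \<open>K\<close> lies inside it. Vertex sets thus stand for unions of Kempe components, and no
  path has to be represented.\<close>

definition kempe_swap :: "('a set \<Rightarrow> nat) \<Rightarrow> nat \<Rightarrow> nat \<Rightarrow> 'a set \<Rightarrow> 'a set \<Rightarrow> nat" where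
  "kempe_swap c \<alpha> \<beta> K e =
     (if e \<inter> K \<noteq> {} \<and> c e = \<alpha> then \<beta> else if e \<inter> K \<noteq> {} \<and> c e = \<beta> then \<alpha> else c e)"

text \<open>If one of two adjacent edges has colour \<alpha> or \<beta> and meets \<open>K\<close>,
  it lies in \<open>K\<close>, so the other one meets \<open>K\<close> too. Hence both are subject
  to the same exchange of colours.\<close>

lemma kempe_swap_proper:
  assumes "proper_edge_colouring F c" "kempe_closed F c \<alpha> \<beta> K"
  shows "proper_edge_colouring F (kempe_swap c \<alpha> \<beta> K)"
  unfolding proper_edge_colouring_def
proof (intro ballI impI)
  fix e f assume ef: "e \<in> F" "f \<in> F" "e \<noteq> f \<and> e \<inter> f \<noteq> {}"
  have "c e \<noteq> c f" using assms(1) ef by (auto simp: proper_edge_colouring_def)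
  moreover have "c e \<in> {\<alpha>, \<beta>} \<Longrightarrow> e \<inter> K \<noteq> {} \<Longrightarrow> f \<inter> K \<noteq> {}"
    using assms(2) ef unfolding kempe_closed_def by blast
  moreover have "c f \<in> {\<alpha>, \<beta>} \<Longrightarrow> f \<inter> K \<noteq> {} \<Longrightarrow> e \<inter> K \<noteq> {}"
    using assms(2) ef unfolding kempe_closed_def by blast
  ultimately show "kempe_swap c \<alpha> \<beta> K e \<noteq> kempe_swap c \<alpha> \<beta> K f"
    by (auto simp: kempe_swap_def)
qed

lemma colours_at_kempe_swap_outside:
  assumes "kempe_closed F c \<alpha> \<beta> K" "v \<notin> K"
  shows "colours_at F (kempe_swap c \<alpha> \<beta> K) v = colours_at F c v"
proof -
  have "kempe_swap c \<alpha> \<beta> K e = c e" if "e \<in> incident_edges F v" for e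
    using that assms unfolding kempe_swap_def kempe_closed_def by auto
  then show ?thesis unfolding colours_at_def by (intro image_cong) auto
qed

lemma colours_at_kempe_swap_other:
  assumes "\<gamma> \<noteq> \<alpha>" "\<gamma> \<noteq> \<beta>"
  shows "\<gamma> \<in> colours_at F (kempe_swap c \<alpha> \<beta> K) v \<longleftrightarrow> \<gamma> \<in> colours_at F c v"
  using assms by (auto simp: colours_at_def image_iff kempe_swap_def)

lemma colours_at_kempe_swap_inside:
  assumes "v \<in> K"
  shows "\<alpha> \<notin> colours_at F c v \<Longrightarrow> \<beta> \<notin> colours_at F (kempe_swap c \<alpha> \<beta> K) v"
    and "\<beta> \<notin> colours_at F c v \<Longrightarrow> \<alpha> \<notin> colours_at F (kempe_swap c \<alpha> \<beta> K) v"
  using assms by (auto simp: colours_at_def image_iff kempe_swap_def split: if_splits)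

lemma kempe_swap_image: "kempe_swap c \<alpha> \<beta> K ` F \<subseteq> c ` F \<union> {\<alpha>, \<beta>}"
  by (auto simp: kempe_swap_def)

text \<open>Follow the alternating path from \<open>x\<close>: \<open>t\<close> is its current end and \<open>\<gamma>\<close> the colour of the next
  edge, if there is one.\<close>

lemma kempe_chain_grow:
  assumes F: "finite F" "\<And>e. e \<in> F \<Longrightarrow> card e = 2" "proper_edge_colouring F c"
    and K: "x \<in> K" "t \<in> K" "{\<gamma>, \<gamma>'} = {\<alpha>, \<beta>}"
    and inner: "\<And>v e. v \<in> K \<Longrightarrow> v \<noteq> t \<Longrightarrow> e \<in> F \<Longrightarrow> v \<in> e \<Longrightarrow> c e \<in> {\<alpha>, \<beta>} \<Longrightarrow> e \<subseteq> K"
    and prev: "\<And>e. e \<in> F \<Longrightarrow> t \<in> e \<Longrightarrow> c e = \<gamma>' \<Longrightarrow> e \<subseteq> K"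
    and full: "\<And>v. v \<in> K \<Longrightarrow> v \<noteq> x \<Longrightarrow> v \<noteq> t \<Longrightarrow> {\<alpha>, \<beta>} \<subseteq> colours_at F c v"
    and "t \<noteq> x \<Longrightarrow> \<gamma>' \<in> colours_at F c t"
  shows "\<exists>K u. x \<in> K \<and> kempe_closed F c \<alpha> \<beta> K \<and>
           (\<forall>v\<in>K - {x, u}. {\<alpha>, \<beta>} \<subseteq> colours_at F c v)"
  using K inner prev full assms(10)
proof (induction "card (\<Union>F - K)" arbitrary: K t \<gamma> \<gamma>' rule: less_induct)
  case less
  show ?case
  proof (cases "\<exists>e\<in>F. t \<in> e \<and> c e = \<gamma> \<and> \<not> e \<subseteq> K")
    case False
    \<comment> \<open>The path cannot leave \<open>K\<close> at \<open>t\<close>, so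
      \<open>K\<close> is closed, and only \<open>x\<close> and \<open>t\<close> may miss one of the
      two colours.\<close>
    have "kempe_closed F c \<alpha> \<beta> K"
      unfolding kempe_closed_def
    proof (intro ballI impI)
      fix e assume e: "e \<in> F" "c e \<in> {\<alpha>, \<beta>}" "e \<inter> K \<noteq> {}"
      show "e \<subseteq> K"
      proof (cases "t \<in> e")
        case True
        have "c e = \<gamma> \<or> c e = \<gamma>'" using e(2) less.prems(3) by auto
        then show ?thesis using False less.prems(5)[OF e(1) True] e(1) True by blast
      next
        case F: False
        then show ?thesis using e less.prems(4)[of _ e] by blast
      qed
    qed
    then show ?thesis using less.prems(1,6) by (intro exI[of _ K] exI[of _ t]) auto
  next
    case True
    then obtain e where e: "e \<in> F" "t \<in> e" "c e = \<gamma>" "\<not> e \<subseteq> K" by blast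
    then obtain w where w: "e = {t, w}" "w \<noteq> t"
      using F(2)[OF e(1)] unfolding card_2_iff by auto
    have wK: "w \<notin> K" using e w less.prems(2) by auto
    have fin: "finite (\<Union>F)"
      using F(1,2) by (auto intro!: finite_Union intro: card_ge_0_finite)
    have "w \<in> \<Union>F" using e w by auto
    then have "\<Union>F - insert w K \<subset> \<Union>F - K" using wK by auto
    then have "card (\<Union>F - insert w K) < card (\<Union>F - K)" using fin by (intro psubset_card_mono) auto
    \<comment> \<open>The edge into \<open>w\<close> has colour \<gamma>, so the path leaves
      \<open>w\<close> along \<gamma>': the two colours exchange roles. The number of vertices
      outside \<open>K\<close> has dropped.\<close>
    then show ?thesis
    proof (rule less.hyps[of "insert w K" w \<gamma>' \<gamma>])
      show "x \<in> insert w K" "w \<in> insert w K" "{\<gamma>', \<gamma>} = {\<alpha>, \<beta>}" using less.prems by auto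
    next
      fix v f assume v: "v \<in> insert w K" "v \<noteq> w" "f \<in> F" "v \<in> f" "c f \<in> {\<alpha>, \<beta>}"
      show "f \<subseteq> insert w K"
      proof (cases "v = t")
        case True
        have "c f = \<gamma> \<or> c f = \<gamma>'" using v less.prems(3) by auto
        then show ?thesis
        proof
          assume "c f = \<gamma>"
          then have "f = e" using proper_unique[OF F(3), of f e t] v e True by auto
          then show ?thesis using w less.prems(2) by auto
        next
          assume "c f = \<gamma>'"
          then show ?thesis using less.prems(5)[of f] v True by auto
        qed
      next
        case False
        then show ?thesis using less.prems(4)[of v f] v by auto
      qed
    next
      fix f assume f: "f \<in> F" "w \<in> f" "c f = \<gamma>"
      then have "f = e" using proper_unique[OF F(3), of f e w] e w by auto
      then show "f \<subseteq> insert w K" using w less.prems(2) by auto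
    next
      fix v assume v: "v \<in> insert w K" "v \<noteq> x" "v \<noteq> w"
      show "{\<alpha>, \<beta>} \<subseteq> colours_at F c v"
      proof (cases "v = t")
        case True
        have "\<gamma> \<in> colours_at F c t" using e by (auto simp: colours_at_def)
        then show ?thesis using less.prems(3,7) True v by auto
      next
        case False
        then show ?thesis using less.prems(6) v by auto
      qed
    next
      show "\<gamma> \<in> colours_at F c w" using e w by (auto simp: colours_at_def)
    qed
  qed
qed

text \<open>As \<alpha> is missing at \<open>x\<close>, the component of \<open>x\<close> is a path
  that starts there. All its vertices except \<open>x\<close> and the other end see both colours, so
  at most one vertex besides \<open>x\<close> misses \<beta>.\<close>

lemma kempe_chain:
  assumes F: "finite F" "\<And>e. e \<in> F \<Longrightarrow> card e = 2" "proper_edge_colouring F c"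
    and "\<alpha> \<notin> colours_at F c x"
  obtains K where "x \<in> K" "kempe_closed F c \<alpha> \<beta> K"
    "\<And>v w. v \<in> K \<Longrightarrow> w \<in> K \<Longrightarrow> v \<noteq> x \<Longrightarrow> w \<noteq> x \<Longrightarrow> \<beta> \<notin> colours_at F c v \<Longrightarrow>
       \<beta> \<notin> colours_at F c w \<Longrightarrow> v = w"
proof -
  have "\<exists>K u. x \<in> K \<and> kempe_closed F c \<alpha> \<beta> K \<and>
           (\<forall>v\<in>K - {x, u}. {\<alpha>, \<beta>} \<subseteq> colours_at F c v)"
    by (rule kempe_chain_grow[OF F, where K = "{x}" and t = x and \<gamma> = \<beta> and \<gamma>' = \<alpha>])
      (use assms(4) in \<open>auto simp: colours_at_def\<close>)
  then show thesis using that by blast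
qed

section \<open>Extending a colouring by one edge\<close>

lemma exists_missing_colour:
  assumes "finite F" "degree F x \<le> D"
  obtains \<gamma> where "\<gamma> \<le> D" "\<gamma> \<notin> colours_at F c x"
proof -
  have "finite (incident_edges F x)" using assms(1) by (simp add: incident_edges_def)
  then have "card (colours_at F c x) \<le> D" "finite (colours_at F c x)"
    using assms(2) card_image_le[of "incident_edges F x" c] unfolding colours_at_def degree_def by auto
  \<comment> \<open>\<open>{..D}\<close> has \<open>D + 1\<close> colours, one more than
    \<open>x\<close> can see.\<close>
  then have "\<not> {..D} \<subseteq> colours_at F c x" using card_mono[of "colours_at F c x" "{..D}"] by auto
  then show thesis using that by auto
qed

text \<open>Take a longest fan starting at \<open>y\<close>, with \<alpha> free at \<open>x\<close>
  and \<beta> free at the last vertex. If \<beta> is also free at \<open>x\<close>, rotate.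
  Otherwise a Kempe swap on the chain of \<open>x\<close> frees \<beta> there, and the fan or a
  prefix of it survives the swap with \<beta> free at its end.\<close>

lemma vizing_extend:
  assumes F: "finite F" "\<And>e. e \<in> F \<Longrightarrow> card e = 2" "proper_edge_colouring F c" "c ` F \<subseteq> {..D}"
    and deg: "\<And>v. degree F v \<le> D" and xy: "x \<noteq> y" "{x, y} \<notin> F"
  shows "\<exists>c'. proper_edge_colouring (insert {x, y} F) c' \<and> c' ` insert {x, y} F \<subseteq> {..D}"
proof -
  define good where "good ys \<longleftrightarrow> fan F c x ys \<and> hd ys = y" for ys
  have fin: "finite (\<Union>F)"
    using F(1,2) by (auto intro!: finite_Union intro: card_ge_0_finite)
  have "good [y]" using xy by (auto simp: good_def fan_def)
  moreover have "length ys < Suc (Suc (card (\<Union>F)))" if "good ys" for ys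
  proof -
    have "set ys \<subseteq> insert y (\<Union>F)"
    proof
      fix v assume "v \<in> set ys"
      then obtain i where i: "i < length ys" "v = ys ! i" by (metis in_set_conv_nth)
      show "v \<in> insert y (\<Union>F)"
      proof (cases i)
        case 0
        then show ?thesis using that i by (auto simp: good_def fan_def hd_conv_nth)
      next
        case (Suc k)
        then have "{x, ys ! i} \<in> F" using that i by (auto simp: good_def fan_def)
        then show ?thesis using i by auto
      qed
    qed
    then have "card (set ys) \<le> card (insert y (\<Union>F))" using fin by (intro card_mono) auto
    also have "\<dots> \<le> Suc (card (\<Union>F))" by (rule card_insert_le_m1) auto
    finally show ?thesis using that distinct_card[of ys] by (auto simp: good_def fan_def)
  qed
  ultimately obtain ys where ys: "good ys" and max: "\<And>zs. good zs \<Longrightarrow> length zs \<le> length ys"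
    using ex_has_greatest_nat[of good "[y]" length] by blast
  have fan: "fan F c x ys" and hd: "hd ys = y" using ys by (auto simp: good_def)
  have ne: "ys \<noteq> []" "distinct ys" "x \<notin> set ys" using fan by (auto simp: fan_def)
  have step: "{x, ys ! Suc i} \<in> F" "c {x, ys ! Suc i} \<notin> colours_at F c (ys ! i)"
    if "Suc i < length ys" for i
    using fan that unfolding fan_def by blast+
  obtain \<alpha> where \<alpha>: "\<alpha> \<le> D" "\<alpha> \<notin> colours_at F c x" using exists_missing_colour[OF F(1) deg] .
  obtain \<beta> where \<beta>: "\<beta> \<le> D" "\<beta> \<notin> colours_at F c (last ys)" using exists_missing_colour[OF F(1) deg] .
  show ?thesis
  proof (cases "\<beta> \<in> colours_at F c x")
    case False
    then obtain c' where "proper_edge_colouring (insert {x, y} F) c'"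
      "c' ` insert {x, y} F \<subseteq> insert \<beta> (c ` F)"
      using fan_shift[OF F(3) fan False \<beta>(2)] hd by auto
    moreover have "insert \<beta> (c ` F) \<subseteq> {..D}" using \<beta>(1) F(4) by auto
    ultimately show ?thesis by blast
  next
    case True
    then obtain e where e: "e \<in> F" "x \<in> e" "c e = \<beta>" by (auto simp: colours_at_def)
    then obtain w where w: "e = {x, w}" "w \<noteq> x"
      using F(2)[OF e(1)] unfolding card_2_iff by auto
    \<comment> \<open>Otherwise \<open>w\<close> could be appended to the fan, as \<beta> is free at
      its last vertex.\<close>
    have "w \<in> set ys"
    proof (rule ccontr)
      assume "w \<notin> set ys"
      moreover have "\<beta> \<notin> colours_at F c (ys ! i)" if "Suc i = length ys" for i
        using \<beta>(2) ne(1) by (simp add: last_conv_nth flip: that)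
      ultimately have "good (ys @ [w])"
        using ys e w unfolding good_def fan_def by (auto simp: nth_append less_Suc_eq)
      then show False using max[of "ys @ [w]"] by simp
    qed
    then obtain j' where j': "j' < length ys" "ys ! j' = w" by (metis in_set_conv_nth)
    \<comment> \<open>\<open>{x, w}\<close> is coloured, so \<open>w\<close> is not the head and has
      a predecessor in the fan; \<beta> is free at that predecessor.\<close>
    have "j' \<noteq> 0" using j'(2) e(1) w(1) fan by (cases ys) (auto simp: fan_def)
    then obtain j where j: "Suc j < length ys" "ys ! Suc j = w" using j' by (cases j') auto
    have \<beta>j: "\<beta> \<notin> colours_at F c (ys ! j)" using step[OF j(1)] j(2) e w by simp
    have ab: "\<alpha> \<noteq> \<beta>" using True \<alpha> by auto
    obtain K where K: "x \<in> K" "kempe_closed F c \<alpha> \<beta> K"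
      and ends: "\<And>v w. v \<in> K \<Longrightarrow> w \<in> K \<Longrightarrow> v \<noteq> x \<Longrightarrow> w \<noteq> x \<Longrightarrow> \<beta> \<notin> colours_at F c v \<Longrightarrow>
       \<beta> \<notin> colours_at F c w \<Longrightarrow> v = w"
      using kempe_chain[OF F(1-3) \<alpha>(2)] by blast
    define c' where "c' = kempe_swap c \<alpha> \<beta> K"
    have c': "proper_edge_colouring F c'" "c' ` F \<subseteq> {..D}"
    proof -
      show "proper_edge_colouring F c'" unfolding c'_def by (rule kempe_swap_proper[OF F(3) K(2)])
      have "c ` F \<union> {\<alpha>, \<beta>} \<subseteq> {..D}" using F(4) \<alpha>(1) \<beta>(1) by auto
      then show "c' ` F \<subseteq> {..D}" unfolding c'_def using kempe_swap_image by (rule subset_trans[rotated])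
    qed
    have \<beta>x: "\<beta> \<notin> colours_at F c' x"
      unfolding c'_def using colours_at_kempe_swap_inside(1)[OF K(1) \<alpha>(2)] .
    \<comment> \<open>No edge at \<open>x\<close> has colour \<alpha> and only \<open>{x, w}\<close>
      has colour \<beta>, so the other fan edges keep colours that the swap does not touch at any
      vertex.\<close>
    have step': "c' {x, ys ! Suc i} \<notin> colours_at F c' (ys ! i)"
      if i: "Suc i < length ys" "i \<noteq> j" for i
    proof -
      let ?e = "{x, ys ! Suc i}"
      have eF: "?e \<in> F" "c ?e \<notin> colours_at F c (ys ! i)" using step i by auto
      have "c ?e \<noteq> \<alpha>" using \<alpha>(2) eF(1) by (auto simp: colours_at_def image_iff)
      moreover have "c ?e \<noteq> \<beta>"
      proof
        assume "c ?e = \<beta>"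
        then have "?e = e" using proper_unique[OF F(3) eF(1) e(1), of x] e by auto
        then have "ys ! Suc i = ys ! Suc j" using w j by (auto simp: doubleton_eq_iff)
        then show False using nth_eq_iff_index_eq[OF ne(2) i(1) j(1)] i(2) by simp
      qed
      ultimately show ?thesis using eF(2) colours_at_kempe_swap_other[of "c ?e" \<alpha> \<beta> F c K "ys ! i"]
        unfolding c'_def by (auto simp: kempe_swap_def)
    qed
    \<comment> \<open>Both \<open>ys ! j\<close> and \<open>last ys\<close> miss \<beta>, so they
      cannot both lie in \<open>K\<close>. If \<open>ys ! j\<close> is outside, the fan is cut off
      after it. If it is inside, the whole fan survives: \<open>{x, w}\<close> now has colour
      \<alpha>, which the swap has freed at \<open>ys ! j\<close>, and \<beta> is still free at
      \<open>last ys\<close>.\<close>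
    have "\<exists>zs. fan F c' x zs \<and> hd zs = y \<and> \<beta> \<notin> colours_at F c' (last zs)"
    proof (cases "ys ! j \<in> K")
      case False
      let ?zs = "take (Suc j) ys"
      have "fan F c' x ?zs"
        using fan step step' j(1) unfolding fan_def by (auto dest: in_set_takeD)
      moreover have "last ?zs = ys ! j" using j(1) by (simp add: take_Suc_conv_app_nth)
      moreover have "hd ?zs = y" using hd ne by (cases ys) auto
      ultimately show ?thesis
        using colours_at_kempe_swap_outside[OF K(2) False] \<beta>j unfolding c'_def
        by (intro exI[of _ ?zs]) auto
    next
      case True
      have "ys ! j \<noteq> x" "last ys \<noteq> x"
        using ne j(1) by (metis nth_mem Suc_lessD, metis last_in_set)
      moreover have "ys ! j \<noteq> last ys"
        using ne j(1) nth_eq_iff_index_eq[OF ne(2), of j "length ys - 1"] by (auto simp: last_conv_nth)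
      ultimately have out: "last ys \<notin> K" using ends[OF True] \<beta>j \<beta>(2) by blast
      have "c' {x, ys ! Suc j} = \<alpha>" using e w j K(1) ab by (auto simp: c'_def kempe_swap_def)
      moreover have "\<alpha> \<notin> colours_at F c' (ys ! j)"
        unfolding c'_def using colours_at_kempe_swap_inside(2)[OF True \<beta>j] .
      ultimately have "fan F c' x ys"
        using fan step step' unfolding fan_def by metis
      then show ?thesis
        using colours_at_kempe_swap_outside[OF K(2) out] \<beta>(2) hd unfolding c'_def
        by (intro exI[of _ ys]) auto
    qed
    then obtain zs where zs: "fan F c' x zs" "hd zs = y" "\<beta> \<notin> colours_at F c' (last zs)" by blast
    obtain c'' where "proper_edge_colouring (insert {x, y} F) c''"
      "c'' ` insert {x, y} F \<subseteq> insert \<beta> (c' ` F)"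
      using fan_shift[OF c'(1) zs(1) \<beta>x zs(3)] zs(2) by auto
    moreover have "insert \<beta> (c' ` F) \<subseteq> {..D}" using \<beta>(1) c'(2) by auto
    ultimately show ?thesis by blast
  qed
qed

lemma degree_mono: "finite E \<Longrightarrow> F \<subseteq> E \<Longrightarrow> degree F x \<le> degree E x"
  unfolding degree_def incident_edges_def by (intro card_mono) auto

lemma vizing:
  assumes "finite E" "\<And>e. e \<in> E \<Longrightarrow> card e = 2" "\<And>v. degree E v \<le> D"
  shows "\<exists>c. proper_edge_colouring E c \<and> c ` E \<subseteq> {..D}"
  using assms
proof (induction E rule: finite_induct)
  case empty
  then show ?case by (auto simp: proper_edge_colouring_def)
next
  case (insert e F)
  have deg: "degree F v \<le> D" for v
    using order_trans[OF degree_mono insert.prems(2)[of v], of F] insert.hyps by blast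
  obtain c where "proper_edge_colouring F c" "c ` F \<subseteq> {..D}" using insert deg by auto
  moreover obtain x y where "e = {x, y}" "x \<noteq> y" using insert.prems(1)[of e] by (auto simp: card_2_iff)
  ultimately show ?case using vizing_extend[of F c D x y] insert deg by auto
qed

section \<open>Matchings that cover exactly one endpoint\<close>

definition matching :: "'a set set \<Rightarrow> bool" where
  "matching M \<longleftrightarrow> (\<forall>e\<in>M. \<forall>f\<in>M. e \<noteq> f \<longrightarrow> e \<inter> f = {})"

definition splits :: "'a set set \<Rightarrow> 'a set \<Rightarrow> bool" where
  "splits M e \<longleftrightarrow> card (e \<inter> \<Union>M) = 1"

lemma splits_doubleton:
  "u \<in> \<Union>M \<Longrightarrow> v \<notin> \<Union>M \<Longrightarrow> splits M {u, v}"
  by (auto simp: splits_def Int_insert_left)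

lemma doubleton_subset_nsets:
  assumes "F \<subseteq> nsets V 2" "{x, y} \<in> F" shows "x \<in> V" "y \<in> V" "x \<noteq> y"
  using subsetD[OF assms] by auto

definition neighbours :: "'a set set \<Rightarrow> 'a \<Rightarrow> 'a set" where
  "neighbours E x = {y. {x, y} \<in> E}"

lemma mem_neighbours [simp]: "y \<in> neighbours E x \<longleftrightarrow> {x, y} \<in> E"
  by (simp add: neighbours_def)

lemma degree_eq_card_neighbours:
  assumes "\<And>e. e \<in> E \<Longrightarrow> card e = 2"
  shows "degree E x = card (neighbours E x)"
proof -
  have "bij_betw (\<lambda>y. {x, y}) (neighbours E x) (incident_edges E x)"
  proof (rule bij_betw_imageI)
    show "inj_on (\<lambda>y. {x, y}) (neighbours E x)" by (auto simp: inj_on_def doubleton_eq_iff)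
    have "e \<in> (\<lambda>y. {x, y}) ` neighbours E x" if e: "e \<in> E" "x \<in> e" for e
    proof -
      obtain a b where "e = {a, b}" using assms[OF e(1)] by (auto simp: card_2_iff)
      then show ?thesis using e by (auto simp: image_iff insert_commute)
    qed
    then show "(\<lambda>y. {x, y}) ` neighbours E x = incident_edges E x" by auto
  qed
  then show ?thesis unfolding degree_def by (metis bij_betw_same_card)
qed

text \<open>From \<open>ln (1 - x) \<ge> - x - 2 * x^2\<close> for \<open>x \<le> 1 / 2\<close>,
  taken at \<open>x = 1 / d\<close>; the exponent becomes
  \<open>- 1 - 2 / d \<ge> - 2\<close>.\<close>

lemma one_minus_inverse_power_ge:
  assumes "d \<ge> (2::nat)"
  shows "exp (- 2 :: real) \<le> (1 - 1 / real d) ^ d"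
proof -
  have "- (1 / real d) - 2 * (1 / real d)\<^sup>2 \<le> ln (1 - 1 / real d)"
    using assms by (intro ln_one_minus_pos_lower_bound) (auto simp: field_simps)
  then have "real d * (- (1 / real d) - 2 * (1 / real d)\<^sup>2) \<le> real d * ln (1 - 1 / real d)"
    by (intro mult_left_mono) auto
  moreover have "real d * (- (1 / real d) - 2 * (1 / real d)\<^sup>2) = - 1 - 2 / real d"
    using assms by (simp add: field_simps power2_eq_square)
  moreover have "2 / real d \<le> 1" using assms by simp
  ultimately have "- 2 \<le> real d * ln (1 - 1 / real d)" by linarith
  then have "exp (- 2) \<le> exp (real d * ln (1 - 1 / real d))" by simp
  also have "\<dots> = (1 - 1 / real d) ^ d"
    using assms by (subst exp_of_nat_mult) (simp add: field_simps)
  finally show ?thesis .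
qed

text \<open>In \<open>f x = (y, b)\<close> the vertex \<open>x\<close> selects its neighbour \<open>y\<close>, and \<open>b\<close> says whether \<open>x\<close> is a
  sender. A sender is matched to the vertex it selects if that is a non-sender which no other sender
  selects.\<close>

definition selection_matching :: "'a set \<Rightarrow> ('a \<Rightarrow> 'a \<times> bool) \<Rightarrow> 'a set set" where
  "selection_matching V f =
     {{x, fst (f x)} | x. x \<in> V \<and> snd (f x) \<and> \<not> snd (f (fst (f x))) \<and>
        (\<forall>z\<in>V. snd (f z) \<longrightarrow> fst (f z) = fst (f x) \<longrightarrow> z = x)}"

text \<open>The sample space of the random selection. Probabilities are expressed by counting in
  this finite product.\<close>

definition selections :: "'a set \<Rightarrow> 'a set set \<Rightarrow> ('a \<Rightarrow> 'a \<times> bool) set" where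
  "selections V F = PiE V (\<lambda>x. neighbours F x \<times> UNIV)"

text \<open>Distinct matched senders select distinct vertices, and a selected partner is never a
  sender.\<close>

lemma matching_selection_matching: "matching (selection_matching V f)"
  unfolding matching_def
proof (intro ballI impI)
  fix e e' assume e: "e \<in> selection_matching V f" "e' \<in> selection_matching V f" "e \<noteq> e'"
  then obtain x x' where x: "e = {x, fst (f x)}" "e' = {x', fst (f x')}" "x \<in> V" "x' \<in> V"
    "snd (f x)" "snd (f x')" "\<not> snd (f (fst (f x)))" "\<not> snd (f (fst (f x')))"
    "\<forall>z\<in>V. snd (f z) \<longrightarrow> fst (f z) = fst (f x) \<longrightarrow> z = x"
    unfolding selection_matching_def by blast
  have "x \<noteq> x'" using e(3) x(1,2) by auto
  moreover from this have "fst (f x') \<noteq> fst (f x)" using x by blast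
  moreover have "x \<noteq> fst (f x')" "x' \<noteq> fst (f x)" using x(5-8) by metis+
  ultimately show "e \<inter> e' = {}" using x(1,2) by auto
qed

lemma selection_matching_subset:
  "f \<in> selections V F \<Longrightarrow> selection_matching V f \<subseteq> F"
  by (force simp: selections_def selection_matching_def PiE_iff mem_Times_iff)

text \<open>An event that matches \<open>u\<close> to \<open>w\<close> and leaves \<open>v\<close>
  uncovered: \<open>u\<close> sends to \<open>w\<close>, both \<open>v\<close> and \<open>w\<close>
  are non-senders, and no other vertex sends to either. It is a product over the vertices, so its
  cardinality factorises.\<close>

definition selection_box :: "'a set set \<Rightarrow> 'a \<Rightarrow> 'a \<Rightarrow> 'a \<Rightarrow> 'a \<Rightarrow> ('a \<times> bool) set" where
  "selection_box F u v w x =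
     (if x = u then {(w, True)}
      else if x = v \<or> x = w then neighbours F x \<times> {False}
      else neighbours F x \<times> UNIV - {(w, True), (v, True)})"

text \<open>\<open>u\<close> is the only sender that selects \<open>w\<close>, so the edge to
  \<open>w\<close> is kept. The non-sender \<open>v\<close> could only be covered by a sender
  selecting it, and there is none.\<close>

lemma selection_box_splits:
  assumes "F \<subseteq> nsets V 2" "u \<in> V" "v \<in> V" "u \<noteq> v" "w \<in> neighbours F u" "w \<noteq> v"
    and f: "f \<in> PiE V (selection_box F u v w)"
  shows "u \<in> \<Union>(selection_matching V f)" "v \<notin> \<Union>(selection_matching V f)" "f \<in> selections V F"
proof -
  have w: "w \<in> V" "w \<noteq> u" using doubleton_subset_nsets[OF assms(1), of u w] assms(5) by auto
  have box: "f x \<in> selection_box F u v w x" if "x \<in> V" for x using f that by (auto simp: PiE_iff)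
  have fu: "f u = (w, True)" using box[of u] assms by (simp add: selection_box_def)
  have fv: "\<not> snd (f v)" using box[of v] assms by (auto simp: selection_box_def)
  have fw: "\<not> snd (f w)" using box[of w] w by (auto simp: selection_box_def split: if_splits)
  have other: "x = u" if "x \<in> V" "snd (f x)" "fst (f x) = w \<or> fst (f x) = v" for x
  proof (rule ccontr)
    assume "x \<noteq> u"
    moreover have "x \<noteq> v" "x \<noteq> w" using that fv fw by auto
    ultimately have "f x \<notin> {(w, True), (v, True)}" using box[OF that(1)] by (simp add: selection_box_def)
    then show False using that by (cases "f x") auto
  qed
  have "\<forall>z\<in>V. snd (f z) \<longrightarrow> fst (f z) = fst (f u) \<longrightarrow> z = u"
    using other by (simp add: fu)
  moreover have "snd (f u)" "\<not> snd (f (fst (f u)))" using fu fw by auto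
  ultimately have "{u, fst (f u)} \<in> selection_matching V f"
    unfolding selection_matching_def using assms(2) by blast
  then show "u \<in> \<Union>(selection_matching V f)" by blast
  show "v \<notin> \<Union>(selection_matching V f)"
  proof
    assume "v \<in> \<Union>(selection_matching V f)"
    then obtain x where x: "v \<in> {x, fst (f x)}" "x \<in> V" "snd (f x)"
      unfolding selection_matching_def by blast
    then have "fst (f x) = v" using fv by auto
    then show False using other[of x] x fu assms(6) by auto
  qed
  show "f \<in> selections V F"
    unfolding selections_def
  proof (rule PiE_I)
    show "f x \<in> neighbours F x \<times> UNIV" if "x \<in> V" for x
      using box[OF that] assms(5) by (auto simp: selection_box_def mem_Times_iff split: if_splits)
    show "f x = undefined" if "x \<notin> V" for x using f that by (auto simp: PiE_iff extensional_def)
  qed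
qed

section \<open>Counting selections in a near-regular graph\<close>

lemma prod_nat_ge_const_mult:
  fixes a :: "'a \<Rightarrow> nat" and b g :: "'a \<Rightarrow> real"
  assumes "\<And>x. x \<in> V \<Longrightarrow> 0 \<le> g x \<and> g x * b x \<le> real (a x)" "\<And>x. x \<in> V \<Longrightarrow> 0 \<le> b x"
  shows "(\<Prod>x\<in>V. g x) * (\<Prod>x\<in>V. b x) \<le> real (\<Prod>x\<in>V. a x)"
  unfolding prod.distrib[symmetric] of_nat_prod using assms by (intro prod_mono) auto

text \<open>At most \<open>r * d\<close> vertices can select a given one, each with probability at
  most \<open>1 / d\<close>; this makes the proportion below depend on \<open>r\<close> alone.
  \<open>d \<ge> 2\<close> gives \<open>u\<close> a neighbour other than \<open>v\<close>.\<close>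

locale near_regular =
  fixes V :: "'a set" and F :: "'a set set" and d r :: nat
  assumes finV: "finite V" and F: "F \<subseteq> nsets V 2" and d: "d \<ge> 2"
    and deg: "\<And>x. x \<in> V \<Longrightarrow> d \<le> degree F x" "\<And>x. x \<in> V \<Longrightarrow> degree F x \<le> r * d"
begin

lemma card_edge: "e \<in> F \<Longrightarrow> card e = 2"
  using F by (auto simp: nsets_def)

lemma neighbours_V: "neighbours F x \<subseteq> V"
  using doubleton_subset_nsets[OF F] by auto

lemma finite_neighbours: "finite (neighbours F x)"
  using neighbours_V finV by (rule finite_subset)

lemma card_neighbours:
  "x \<in> V \<Longrightarrow> d \<le> card (neighbours F x)" "x \<in> V \<Longrightarrow> card (neighbours F x) \<le> r * d"
  using deg[of x] degree_eq_card_neighbours[of F x] card_edge by auto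

lemma card_selections: "card (selections V F) = (\<Prod>x\<in>V. 2 * card (neighbours F x))"
  unfolding selections_def using finV by (simp add: card_PiE card_cartesian_product mult.commute)

text \<open>The choice at \<open>u\<close> has probability
  \<open>1 / (2 * card (neighbours F u))\<close>, and \<open>v\<close> and \<open>w\<close> are
  non-senders with probability \<open>1 / 2\<close> each. At most \<open>2 * r * d\<close> vertices
  are adjacent to \<open>v\<close> or \<open>w\<close>; each avoids them with probability at least
  \<open>1 - 1 / d\<close>, which yields \<open>exp (- 4 * r)\<close>.\<close>

lemma card_selection_box:
  assumes uv: "u \<in> V" "v \<in> V" "u \<noteq> v" and w: "w \<in> neighbours F u" "w \<noteq> v"
  shows "exp (- 4 * real r) / (8 * card (neighbours F u)) * card (selections V F)
           \<le> card (PiE V (selection_box F u v w))"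
proof -
  have w': "w \<in> V" "w \<noteq> u" using doubleton_subset_nsets[OF F, of u w] w(1) by auto
  define h :: "'a \<Rightarrow> real" where
    "h x = (if x = u then 1 / (2 * card (neighbours F u)) else if x = v \<or> x = w then 1 / 2 else 1)" for x
  define W where "W = neighbours F w \<union> neighbours F v"
  \<comment> \<open>The factor is also kept at \<open>u\<close>, \<open>v\<close> and
    \<open>w\<close> if they lie in \<open>W\<close>. There it only weakens the bound, and the
    product over \<open>V\<close> is a pure power.\<close>
  define b :: "'a \<Rightarrow> real" where "b x = (if x \<in> W then 1 - 1 / real d else 1)" for x
  have b: "0 \<le> b x" "b x \<le> 1" for x using d by (auto simp: b_def)
  have h: "0 \<le> h x" for x by (auto simp: h_def)
  have W: "W \<subseteq> V" using neighbours_V by (auto simp: W_def)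
  have "card W \<le> 2 * r * d"
    using card_Un_le[of "neighbours F w" "neighbours F v"] card_neighbours(2)[OF w'(1)]
      card_neighbours(2)[OF uv(2)] unfolding W_def by linarith
  moreover have "prod b V = (1 - 1 / real d) ^ card W"
    unfolding b_def using finV W by (simp add: prod.If_cases Int_absorb1)
  ultimately have "(1 - 1 / real d) ^ (2 * r * d) \<le> prod b V"
    using d by (auto intro!: power_decreasing)
  moreover have "exp (- 4 * real r) \<le> (1 - 1 / real d) ^ (2 * r * d)"
  proof -
    have "exp (- 4 * real r) = exp (- 2) ^ (2 * r)"
      by (simp flip: exp_of_nat_mult)
    also have "\<dots> \<le> ((1 - 1 / real d) ^ d) ^ (2 * r)"
      using one_minus_inverse_power_ge[OF d] by (intro power_mono) auto
    finally show ?thesis by (simp add: power_mult [symmetric] mult.commute)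
  qed
  ultimately have pb: "exp (- 4 * real r) \<le> prod b V" by linarith
  have ph: "prod h V = 1 / (8 * card (neighbours F u))"
  proof -
    have "prod h V = prod h {u, v, w}"
      using finV uv w' by (intro prod.mono_neutral_right) (auto simp: h_def)
    then show ?thesis using uv w w' by (auto simp: h_def)
  qed
  have "(\<Prod>x\<in>V. h x * b x) * (\<Prod>x\<in>V. real (2 * card (neighbours F x)))
      \<le> real (\<Prod>x\<in>V. card (selection_box F u v w x))"
  proof (intro prod_nat_ge_const_mult conjI)
    fix x assume x: "x \<in> V"
    let ?n = "card (neighbours F x)"
    have n: "d \<le> ?n" using card_neighbours x by auto
    show "0 \<le> h x * b x" using h b by simp
    show "h x * b x * real (2 * ?n) \<le> real (card (selection_box F u v w x))"
    proof (cases "x = u \<or> x = v \<or> x = w")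
      case True
      then have "h x * real (2 * ?n) \<le> real (card (selection_box F u v w x))"
        using n d uv w' by (auto simp: h_def selection_box_def card_cartesian_product)
      moreover have "b x * (h x * real (2 * ?n)) \<le> 1 * (h x * real (2 * ?n))"
        using b h by (intro mult_right_mono) auto
      ultimately show ?thesis by (simp add: mult_ac)
    next
      case False
      let ?P = "neighbours F x \<times> (UNIV :: bool set)"
      have hx: "h x = 1" using False by (simp add: h_def)
      have sb: "selection_box F u v w x = ?P - {(w, True), (v, True)}"
        using False by (simp add: selection_box_def)
      have cP: "card ?P = 2 * ?n" by (simp add: card_cartesian_product)
      show ?thesis
      proof (cases "x \<in> W")
        case True
        \<comment> \<open>At most two of the \<open>2 * ?n\<close> choices are lost, and
          \<open>?n \<ge> d\<close>.\<close>
        have "card ?P \<le> card (?P - {(w, True), (v, True)}) + card {(w, True), (v, True)}"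
          by (metis diff_card_le_card_Diff finite.emptyI finite.insertI le_diff_conv)
        moreover have "card {(w, True), (v, True)} \<le> 2" by (simp add: card_insert_if)
        ultimately have "2 * real ?n - 2 \<le> card (selection_box F u v w x)"
          unfolding sb cP by linarith
        moreover have "1 \<le> real ?n / real d" using n d by simp
        ultimately show ?thesis using True hx by (simp add: b_def algebra_simps)
      next
        case F: False
        then have "?P - {(w, True), (v, True)} = ?P" by (auto simp: W_def insert_commute)
        then show ?thesis using F hx cP unfolding sb by (simp add: b_def)
      qed
    qed
  qed auto
  then have "prod h V * prod b V * card (selections V F) \<le> card (PiE V (selection_box F u v w))"
    using finV by (simp add: card_PiE card_selections prod.distrib)
  moreover have "exp (- 4 * real r) / (8 * card (neighbours F u)) * card (selections V F)
      \<le> prod h V * prod b V * card (selections V F)"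
    unfolding ph using pb by (intro mult_right_mono) (auto intro!: divide_right_mono)
  ultimately show ?thesis by linarith
qed

text \<open>The boxes for different \<open>w\<close> are disjoint because \<open>f u\<close>
  determines \<open>w\<close>. At least half of the neighbours of \<open>u\<close> differ from
  \<open>v\<close>, so summing over them cancels the degree and turns 8 into 16.\<close>

lemma card_selections_splitting:
  assumes uv: "u \<in> V" "v \<in> V" "u \<noteq> v"
  shows "exp (- 4 * real r) / 16 * card (selections V F)
           \<le> card {f \<in> selections V F. splits (selection_matching V f) {u, v}}"
proof -
  let ?B = "\<lambda>w. PiE V (selection_box F u v w)"
  let ?N = "neighbours F u - {v}"
  let ?k = "exp (- 4 * real r) / (8 * card (neighbours F u)) * card (selections V F)"
  have fin: "finite (selections V F)"
    unfolding selections_def using finV finite_neighbours by (intro finite_PiE) auto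
  have sub: "?B w \<subseteq> {f \<in> selections V F. splits (selection_matching V f) {u, v}}" if "w \<in> ?N" for w
  proof
    fix f assume f: "f \<in> ?B w"
    have w: "w \<in> neighbours F u" "w \<noteq> v" using that by auto
    show "f \<in> {f \<in> selections V F. splits (selection_matching V f) {u, v}}"
      using splits_doubleton selection_box_splits[OF F uv w f] by simp
  qed
  have N: "card (neighbours F u) \<le> 2 * card ?N"
  proof -
    have "card (neighbours F u) \<le> card ?N + 1"
      using card_Diff1_le[of "neighbours F u" v]
      by (metis Suc_eq_plus1 card.insert_remove card_mono finite_insert finite_neighbours subset_insertI)
    then show ?thesis using card_neighbours(1)[OF uv(1)] d by linarith
  qed
  have n0: "0 < card (neighbours F u)" using card_neighbours(1)[OF uv(1)] d by linarith
  have "exp (- 4 * real r) / 16 * card (selections V F)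
      = (card (neighbours F u) / 2) * ?k" using n0 by (simp add: field_simps)
  also have "\<dots> \<le> card ?N * ?k"
    using N by (intro mult_right_mono) auto
  also have "\<dots> = (\<Sum>w\<in>?N. ?k)" by simp
  also have "\<dots> \<le> (\<Sum>w\<in>?N. real (card (?B w)))"
    using card_selection_box[OF uv] by (intro sum_mono) auto
  also have "\<dots> = card (\<Union>w\<in>?N. ?B w)"
  proof (subst card_UN_disjoint)
    show "finite ?N" using finite_neighbours by auto
    show "\<forall>w\<in>?N. finite (?B w)"
      using sub fin by (metis (no_types, lifting) finite_subset mem_Collect_eq subsetI)
    show "\<forall>i\<in>?N. \<forall>j\<in>?N. i \<noteq> j \<longrightarrow> ?B i \<inter> ?B j = {}"
    proof (intro ballI impI)
      fix i j :: 'a assume "i \<noteq> j"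
      have "f u = (i, True)" if "f \<in> ?B i" for f and i :: 'a
      proof -
        have "f u \<in> selection_box F u v i u" using that uv(1) by (rule PiE_mem)
        then show ?thesis by (simp add: selection_box_def)
      qed
      from this[of _ i] this[of _ j] show "?B i \<inter> ?B j = {}" using \<open>i \<noteq> j\<close> by fastforce
    qed
  qed auto
  also have "\<dots> \<le> card {f \<in> selections V F. splits (selection_matching V f) {u, v}}"
    using UN_least[of ?N ?B, OF sub] fin by (intro of_nat_mono card_mono) auto
  finally show ?thesis .
qed

text \<open>Averaging over all selections, by double counting pairs of a selection and a member of
  \<open>U\<close>. The set \<open>U\<close> is not confined to \<open>F\<close>: edges removed with
  earlier matchings still have to be split.\<close>

lemma exists_splitting_matching:
  assumes U: "U \<subseteq> nsets V 2"
  shows "\<exists>M\<subseteq>F. matching M \<and> exp (- 4 * real r) / 16 * card U \<le> card {e \<in> U. splits M e}"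
proof (rule ccontr)
  assume neg: "\<not> ?thesis"
  let ?S = "selections V F" and ?M = "selection_matching V" and ?\<kappa> = "exp (- 4 * real r) / 16"
  have fin: "finite ?S"
    unfolding selections_def using finV finite_neighbours by (intro finite_PiE) auto
  have finU: "finite U" using U finV by (meson finite_imp_finite_nsets finite_subset)
  have ne: "?S \<noteq> {}"
    unfolding selections_def using card_neighbours(1) d by (fastforce simp: PiE_eq_empty_iff)
  have "card {e \<in> U. splits (?M f) e} < ?\<kappa> * card U" if "f \<in> ?S" for f
    using neg selection_matching_subset[OF that] matching_selection_matching[of V f]
    by (auto simp: not_le)
  then have "(\<Sum>f\<in>?S. real (card {e \<in> U. splits (?M f) e})) < (\<Sum>f\<in>?S. ?\<kappa> * card U)"
    using fin ne by (intro sum_strict_mono) auto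
  also have "\<dots> = (\<Sum>e\<in>U. ?\<kappa> * card ?S)" by simp
  also have "\<dots> \<le> (\<Sum>e\<in>U. real (card {f \<in> ?S. splits (?M f) e}))"
  proof (rule sum_mono)
    fix e assume "e \<in> U"
    then obtain u v where "e = {u, v}" "u \<in> V" "v \<in> V" "u \<noteq> v" using U by (auto elim!: nsets2_E)
    then show "?\<kappa> * card ?S \<le> real (card {f \<in> ?S. splits (?M f) e})"
      using card_selections_splitting by simp
  qed
  also have "\<dots> = (\<Sum>f\<in>?S. real (card {e \<in> U. splits (?M f) e}))"
    using sum_multicount_gen[of U ?S "\<lambda>e f. splits (?M f) e" "\<lambda>f. card {e \<in> U. splits (?M f) e}"]
      fin finU by (simp flip: of_nat_sum)
  finally show False by simp
qed

end

section \<open>Repeated removal of matchings\<close>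

lemma degree_matching_le:
  assumes "matching M" shows "degree M x \<le> 1"
proof -
  have "\<forall>e\<in>incident_edges M x. \<forall>f\<in>incident_edges M x. e = f"
    using assms by (auto simp: matching_def) blast+
  then show ?thesis unfolding degree_def
    by (metis card_le_Suc0_iff_eq card.infinite One_nat_def zero_le_one)
qed

lemma degree_Diff_matchings:
  assumes "finite E" "\<And>i. i < k \<Longrightarrow> matching (M i)" "\<And>i. i < k \<Longrightarrow> M i \<subseteq> E"
  shows "degree E x \<le> degree (E - (\<Union>i<k. M i)) x + k"
proof -
  let ?F = "E - (\<Union>i<k. M i)"
  have fin: "finite (incident_edges E x)" using assms(1) by (simp add: incident_edges_def)
  have "incident_edges E x \<subseteq> incident_edges ?F x \<union> (\<Union>i<k. incident_edges (M i) x)" by auto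
  moreover have "finite (incident_edges ?F x \<union> (\<Union>i<k. incident_edges (M i) x))"
    by (intro finite_subset[OF _ fin]) (auto dest: subsetD[OF assms(3)])
  ultimately have "degree E x \<le> card (incident_edges ?F x \<union> (\<Union>i<k. incident_edges (M i) x))"
    unfolding degree_def by (intro card_mono)
  also have "\<dots> \<le> degree ?F x + card (\<Union>i<k. incident_edges (M i) x)"
    unfolding degree_def by (rule card_Un_le)
  also have "card (\<Union>i<k. incident_edges (M i) x) \<le> (\<Sum>i<k. degree (M i) x)"
    unfolding degree_def by (rule card_UN_le) simp
  also have "\<dots> \<le> (\<Sum>i<k. 1)" using degree_matching_le[OF assms(2)] by (intro sum_mono) auto
  finally show ?thesis by simp
qed

text \<open>Each round takes a matching from the remaining graph and splits a fixed proportion of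
  the unsplit edges. The surplus \<open>L\<close> in the minimum degree pays for the removals, so at
  least \<open>d\<close> is left in every round.\<close>

lemma exists_disjoint_splitting_matchings:
  assumes V: "finite V" "E \<subseteq> nsets V 2" "d \<ge> 2"
    and deg: "\<forall>x\<in>V. d + L \<le> degree E x \<and> degree E x \<le> r * d"
    and "k \<le> L"
  shows "\<exists>M. (\<forall>i<k. M i \<subseteq> E \<and> matching (M i)) \<and> (\<forall>i<k. \<forall>j<k. i \<noteq> j \<longrightarrow> M i \<inter> M j = {}) \<and>
           card {e \<in> E. \<forall>i<k. \<not> splits (M i) e} \<le> (1 - exp (- 4 * real r) / 16) ^ k * card E"
  using \<open>k \<le> L\<close>
proof (induction k)
  case 0
  then show ?case by simp
next
  case (Suc k)
  let ?\<kappa> = "exp (- 4 * real r) / 16"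
  have finE: "finite E" using V by (meson finite_imp_finite_nsets finite_subset)
  from Suc obtain M where M: "\<forall>i<k. M i \<subseteq> E \<and> matching (M i)"
    "\<forall>i<k. \<forall>j<k. i \<noteq> j \<longrightarrow> M i \<inter> M j = {}"
    "card {e \<in> E. \<forall>i<k. \<not> splits (M i) e} \<le> (1 - ?\<kappa>) ^ k * card E" by auto
  define F where "F = E - (\<Union>i<k. M i)"
  define U where "U = {e \<in> E. \<forall>i<k. \<not> splits (M i) e}"
  interpret near_regular V F d r
  proof
    show "F \<subseteq> nsets V 2" using V by (auto simp: F_def)
    show "degree F x \<le> r * d" if "x \<in> V" for x
      using degree_mono[OF finE, of F x] bspec[OF deg that] by (auto simp: F_def)
    show "d \<le> degree F x" if "x \<in> V" for x
      using degree_Diff_matchings[OF finE, of k M x] M(1) bspec[OF deg that] Suc.prems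
      by (auto simp: F_def)
  qed fact+
  have U: "U \<subseteq> nsets V 2" using V by (auto simp: U_def)
  then have finU: "finite U" using V by (meson finite_imp_finite_nsets finite_subset)
  obtain N where N: "N \<subseteq> F" "matching N" "?\<kappa> * card U \<le> card {e \<in> U. splits N e}"
    using exists_splitting_matching[OF U] by blast
  let ?M = "M(k := N)"
  have "{e \<in> E. \<forall>i<Suc k. \<not> splits (?M i) e} = U - {e \<in> U. splits N e}"
    by (auto simp: U_def less_Suc_eq)
  then have "real (card {e \<in> E. \<forall>i<Suc k. \<not> splits (?M i) e}) = card U - real (card {e \<in> U. splits N e})"
    using finU by (simp add: card_Diff_subset of_nat_diff card_mono)
  also have "\<dots> \<le> (1 - ?\<kappa>) * card U" using N(3) by (simp add: algebra_simps)
  also have "\<dots> \<le> (1 - ?\<kappa>) * ((1 - ?\<kappa>) ^ k * card E)"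
    using M(3) unfolding U_def by (intro mult_left_mono) (auto intro: order_trans[of _ 1])
  finally have "card {e \<in> E. \<forall>i<Suc k. \<not> splits (?M i) e} \<le> (1 - ?\<kappa>) ^ Suc k * card E"
    by (simp add: mult.assoc)
  moreover have "\<forall>i<Suc k. ?M i \<subseteq> E \<and> matching (?M i)"
    using M(1) N by (auto simp: less_Suc_eq F_def)
  moreover have "\<forall>i<Suc k. \<forall>j<Suc k. i \<noteq> j \<longrightarrow> ?M i \<inter> ?M j = {}"
    using M(2) N(1) by (auto simp: less_Suc_eq F_def)
  ultimately show ?case by blast
qed

section \<open>From splitting matchings to the colouring\<close>

lemma chi_pOCF_le:
  assumes "proper_edge_colouring E c" "open_conflict_free E c" "card (c ` E) \<le> k"
  shows "chi_pOCF E \<le> k"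
proof -
  have "chi_pOCF E \<le> card (c ` E)"
    unfolding chi_pOCF_def using assms(1,2) by (intro Least_le) blast
  then show ?thesis using assms(3) by simp
qed

text \<open>The matching edge at \<open>u\<close> differs from \<open>e\<close> as it avoids
  \<open>v\<close>. Any other edge of the class in the neighbourhood would also meet
  \<open>e\<close> in \<open>u\<close>, against the matching property.\<close>

lemma satisfied_if_splits:
  assumes e: "e = {u, v}" and u: "u \<in> \<Union>M" and v: "v \<notin> \<Union>M"
    and M: "matching M" "M \<subseteq> E" and c: "\<And>f. f \<in> E \<Longrightarrow> c f = k \<longleftrightarrow> f \<in> M"
  shows "satisfied E c e"
proof -
  obtain m where m: "m \<in> M" "u \<in> m" using u by blast
  have "m \<in> open_nbhd E e \<and> c m = k"
    using m v M(2) c[of m] by (auto simp: open_nbhd_def e)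
  moreover have "f = m" if "f \<in> open_nbhd E e \<and> c f = k" for f
  proof -
    have f: "f \<in> E" "u \<in> f \<or> v \<in> f" "f \<in> M" using that c[of f] by (auto simp: open_nbhd_def e)
    then have "u \<in> f" using v by blast
    then show ?thesis using M(1) f(3) m by (auto simp: matching_def)
  qed
  ultimately show ?thesis unfolding satisfied_def by blast
qed

text \<open>\<open>L\<close> private colours for the matchings are added to the \<open>D + 1\<close>
  colours of Vizing's theorem on the rest.\<close>

lemma chi_pOCF_le_near_regular:
  assumes V: "finite V" "E \<subseteq> nsets V 2" "d \<ge> 2"
    and deg: "\<forall>x\<in>V. d + L \<le> degree E x \<and> degree E x \<le> r * d"
    and D: "\<And>x. x \<in> V \<Longrightarrow> degree E x \<le> D"
    and L: "(1 - exp (- 4 * real r) / 16) ^ L * card E < 1"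
  shows "chi_pOCF E \<le> D + 1 + L"
proof -
  have finE: "finite E" using V by (meson finite_imp_finite_nsets finite_subset)
  have card2: "card e = 2" "e \<subseteq> V" if "e \<in> E" for e using V that by (auto simp: nsets_def)
  from exists_disjoint_splitting_matchings[OF V deg order_refl]
  obtain M where M0: "\<forall>i<L. M i \<subseteq> E \<and> matching (M i)"
    "\<forall>i<L. \<forall>j<L. i \<noteq> j \<longrightarrow> M i \<inter> M j = {}"
    and rest: "card {e \<in> E. \<forall>i<L. \<not> splits (M i) e} \<le> (1 - exp (- 4 * real r) / 16) ^ L * card E"
    by (elim exE conjE)
  have M: "M i \<subseteq> E" "matching (M i)" if "i < L" for i using M0(1) that by auto
  have disj: "M i \<inter> M j = {}" if "i < L" "j < L" "i \<noteq> j" for i j using M0(2) that by auto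
  \<comment> \<open>A natural number below 1 vanishes, so every edge is split.\<close>
  have "card {e \<in> E. \<forall>i<L. \<not> splits (M i) e} = 0" using rest L by linarith
  then have split: "\<exists>i<L. splits (M i) e" if "e \<in> E" for e using finE that by auto
  define F where "F = E - (\<Union>i<L. M i)"
  have "degree F x \<le> D" for x
  proof (cases "x \<in> V")
    case True
    then show ?thesis using degree_mono[OF finE, of F x] D by (fastforce simp: F_def)
  next
    case False
    then have "incident_edges F x = {}" using card2 by (auto simp: F_def incident_edges_def)
    then show ?thesis by (simp add: degree_def)
  qed
  then obtain c where c: "proper_edge_colouring F c" "c ` F \<subseteq> {..D}"
    using vizing[of F D] finE card2 by (auto simp: F_def)
  define \<iota> where "\<iota> e = (THE i. i < L \<and> e \<in> M i)" for e
  have \<iota>: "\<iota> e = i" if "i < L" "e \<in> M i" for e i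
    unfolding \<iota>_def using that disj by (intro the_equality) blast+
  \<comment> \<open>Vizing's colours are \<open>0\<close> to \<open>D\<close>, so the private ones
    start at \<open>D + 1\<close>. By \<open>iff\<close>, the class of \<open>D + 1 + i\<close>
    within \<open>E\<close> is exactly \<open>M i\<close>.\<close>
  define c' where "c' e = (if e \<in> F then c e else D + 1 + \<iota> e)" for e
  have c'F: "c' e = c e" "c e \<le> D" if "e \<in> F" for e using that c(2) by (auto simp: c'_def)
  have c'M: "c' e = D + 1 + i" if "i < L" "e \<in> M i" for e i
    using that \<iota>[OF that] by (auto simp: c'_def F_def)
  have cases: "e \<in> F \<or> (\<exists>i<L. e \<in> M i)" if "e \<in> E" for e using that by (auto simp: F_def)
  have iff: "c' e = D + 1 + i \<longleftrightarrow> e \<in> M i" if "e \<in> E" "i < L" for e i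
    using cases[OF that(1)] c'F[of e] c'M[of _ e] that(2) by fastforce
  show ?thesis
  proof (rule chi_pOCF_le)
    show "proper_edge_colouring E c'"
      unfolding proper_edge_colouring_def
    proof (intro ballI impI notI)
      fix e f assume ef: "e \<in> E" "f \<in> E" "e \<noteq> f \<and> e \<inter> f \<noteq> {}" "c' e = c' f"
      show False
      proof (cases "e \<in> F \<and> f \<in> F")
        case True
        then show False using c(1) ef c'F by (auto simp: proper_edge_colouring_def)
      next
        case False
        then obtain i where i: "i < L" "e \<in> M i \<or> f \<in> M i" using cases ef by blast
        then have "e \<in> M i" "f \<in> M i" using iff ef i by metis+
        then show False using M(2)[OF i(1)] ef by (auto simp: matching_def)
      qed
    qed
    show "open_conflict_free E c'"
      unfolding open_conflict_free_def
    proof (intro ballI impI)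
      fix e assume e: "e \<in> E"
      then obtain i where i: "i < L" "splits (M i) e" using split by blast
      then obtain u where u: "e \<inter> \<Union>(M i) = {u}" by (auto simp: splits_def card_1_singleton_iff)
      obtain v where v: "e = {u, v}" "v \<noteq> u"
      proof -
        obtain a b where "e = {a, b}" "a \<noteq> b" using card2(1)[OF e] by (auto simp: card_2_iff)
        moreover have "u \<in> e" using u by auto
        ultimately show thesis using that[of b] that[of a] by auto
      qed
      show "satisfied E c' e"
        using u v M(1,2)[OF i(1)] iff[OF _ i(1)] by (intro satisfied_if_splits[OF v(1), of "M i"]) auto
    qed
    have "c' ` E \<subseteq> {..<D + 1 + L}"
    proof
      fix k assume "k \<in> c' ` E"
      then obtain e where "e \<in> E" "k = c' e" by blast
      then show "k \<in> {..<D + 1 + L}" using cases c'F[of e] c'M[of _ e] by fastforce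
    qed
    then show "card (c' ` E) \<le> D + 1 + L" by (metis card_lessThan card_mono finite_lessThan)
  qed
qed

section \<open>Degrees of the random graph\<close>

lemma set_pmf_binomial_random_graph:
  "E \<in> set_pmf (binomial_random_graph n p) \<Longrightarrow> E \<subseteq> nsets {..<n} 2"
  by (auto simp: binomial_random_graph_def)

lemma finite_set_pmf_binomial_random_graph: "finite (set_pmf (binomial_random_graph n p))"
proof (rule finite_subset)
  show "set_pmf (binomial_random_graph n p) \<subseteq> Pow (nsets {..<n} 2)"
    using set_pmf_binomial_random_graph by blast
qed (simp add: finite_imp_finite_nsets)

lemma card_incident_edges_nsets:
  assumes "v < n" shows "card {e \<in> nsets {..<n} 2. v \<in> e} = n - 1"
proof -
  have "{e \<in> nsets {..<n} 2. v \<in> e} = (\<lambda>w. {v, w}) ` ({..<n} - {v})"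
    using assms by (auto simp: nsets_2_eq image_iff insert_commute)
  moreover have "inj_on (\<lambda>w. {v, w}) ({..<n} - {v})" by (auto simp: inj_on_def doubleton_eq_iff)
  ultimately show ?thesis using assms by (simp add: card_image)
qed

text \<open>The exponential is a product over independent pairs. Each of the \<open>n - 1\<close>
  pairs containing \<open>v\<close> contributes the Bernoulli mean \<open>1 - p + p * exp t\<close>,
  every other pair contributes 1.\<close>

lemma expectation_exp_degree:
  assumes p: "0 \<le> p" "p \<le> 1" and v: "v < n"
  shows "measure_pmf.expectation (binomial_random_graph n p) (\<lambda>E. exp (t * real (degree E v)))
           = (1 + p * (exp t - 1)) ^ (n - 1)"
proof -
  let ?A = "nsets {..<n} 2"
  have finA: "finite ?A" by (simp add: finite_imp_finite_nsets)
  have deg: "exp (t * real (degree {e \<in> ?A. f e} v)) = (\<Prod>e\<in>?A. if v \<in> e \<and> f e then exp t else 1)" for f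
  proof -
    have "degree {e \<in> ?A. f e} v = card {e \<in> ?A. v \<in> e \<and> f e}"
      unfolding degree_def incident_edges_def by (rule arg_cong[of _ _ card]) auto
    then have "exp (t * real (degree {e \<in> ?A. f e} v)) = exp t ^ card {e \<in> ?A. v \<in> e \<and> f e}"
      by (metis exp_of_nat_mult mult.commute)
    also have "\<dots> = (\<Prod>e\<in>?A. if v \<in> e \<and> f e then exp t else 1)"
      using finA by (simp add: prod.If_cases Int_def)
    finally show ?thesis .
  qed
  have "measure_pmf.expectation (binomial_random_graph n p) (\<lambda>E. exp (t * real (degree E v)))
      = measure_pmf.expectation (Pi_pmf ?A False (\<lambda>_. bernoulli_pmf p))
          (\<lambda>f. \<Prod>e\<in>?A. if v \<in> e \<and> f e then exp t else 1)"
    unfolding binomial_random_graph_def integral_map_pmf deg ..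
  also have "\<dots> = (\<Prod>e\<in>?A. measure_pmf.expectation (bernoulli_pmf p) (\<lambda>b. if v \<in> e \<and> b then exp t else 1))"
    using finA by (intro expectation_prod_Pi_pmf) (auto intro: integrable_measure_pmf_finite)
  also have "\<dots> = (\<Prod>e\<in>?A. if v \<in> e then 1 + p * (exp t - 1) else 1)"
    using p by (intro prod.cong) (auto simp: algebra_simps)
  also have "\<dots> = (1 + p * (exp t - 1)) ^ card {e \<in> ?A. v \<in> e}"
    using finA by (simp add: prod.If_cases Int_def)
  finally show ?thesis using card_incident_edges_nsets[OF v] by simp
qed

text \<open>Markov's inequality for the exponential moment. Keeping \<open>t\<close> inside the
  event lets one statement serve both tails, by the sign of \<open>t\<close>.\<close>

lemma prob_degree_exp_bound:
  assumes p: "0 \<le> p" "p \<le> 1" and v: "v < n"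
  shows "measure_pmf.prob (binomial_random_graph n p) {E. s \<le> t * real (degree E v)}
           \<le> exp ((exp t - 1) * (real (n - 1) * p) - s)"
proof -
  let ?G = "binomial_random_graph n p"
  have "measure_pmf.prob ?G {E. s \<le> t * real (degree E v)}
      = measure_pmf.prob ?G {E \<in> space ?G. exp s \<le> exp (t * real (degree E v))}" by simp
  also have "\<dots> \<le> measure_pmf.expectation ?G (\<lambda>E. exp (t * real (degree E v))) / exp s"
    by (intro integral_Markov_inequality_measure[of _ _ "{}"])
      (auto intro: integrable_measure_pmf_finite finite_set_pmf_binomial_random_graph)
  also have "\<dots> = (1 + p * (exp t - 1)) ^ (n - 1) / exp s"
    using expectation_exp_degree[OF assms] by simp
  also have "(1 + p * (exp t - 1)) ^ (n - 1) \<le> exp (p * (exp t - 1)) ^ (n - 1)"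
  proof (rule power_mono)
    have "0 \<le> (1 - p) + p * exp t" using p by simp
    then show "0 \<le> 1 + p * (exp t - 1)" by (simp add: algebra_simps)
  qed (rule exp_ge_add_one_self)
  also have "\<dots> = exp ((exp t - 1) * (real (n - 1) * p))"
    by (simp flip: exp_of_nat_mult add: mult_ac)
  finally show ?thesis by (simp add: exp_diff divide_right_mono)
qed

text \<open>Union bound over the vertices. With \<open>t = 1\<close> the exponent is at most
  \<open>- m\<close> because \<open>exp 1 \<le> 3\<close>; with \<open>t = - 1\<close> it is at most
  \<open>- m / 4\<close> because \<open>exp (- 1) \<le> 1 / 2\<close>.\<close>

lemma prob_degrees_concentrated:
  fixes p m :: real and n :: nat
  assumes p: "0 \<le> p" "p \<le> 1"
  defines "m \<equiv> real (n - 1) * p"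
  shows "1 - 2 * real n * exp (- m / 4) \<le>
    measure_pmf.prob (binomial_random_graph n p) {E. \<forall>v<n. m / 4 < degree E v \<and> degree E v < 3 * m}"
proof -
  let ?G = "binomial_random_graph n p"
  let ?B = "\<lambda>v. {E. 3 * m \<le> 1 * real (degree E v)} \<union> {E. - (m / 4) \<le> (- 1) * real (degree E v)}"
  have m: "0 \<le> m" using p by (simp add: m_def)
  have "measure_pmf.prob ?G (?B v) \<le> 2 * exp (- m / 4)" if "v < n" for v
  proof -
    have "measure_pmf.prob ?G {E. 3 * m \<le> 1 * real (degree E v)} \<le> exp ((exp 1 - 1) * m - 3 * m)"
      unfolding m_def by (rule prob_degree_exp_bound[OF p that])
    also have "(exp 1 - 1) * m \<le> (3 - 1) * m"
      using m exp_le by (intro mult_right_mono) auto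
    also have "(3 - 1) * m - 3 * m \<le> - m / 4" using m by simp
    finally have up: "measure_pmf.prob ?G {E. 3 * m \<le> 1 * real (degree E v)} \<le> exp (- m / 4)" by simp
    have "measure_pmf.prob ?G {E. - (m / 4) \<le> (- 1) * real (degree E v)}
        \<le> exp ((exp (- 1) - 1) * m - (- (m / 4)))"
      unfolding m_def by (rule prob_degree_exp_bound[OF p that])
    also have "(exp (- 1) - 1) * m \<le> (1 / 2 - 1) * m"
      using m exp_ge_add_one_self[of "1::real"]
      by (intro mult_right_mono) (auto simp: exp_minus inverse_eq_divide field_simps)
    also have "(1 / 2 - 1) * m - (- (m / 4)) \<le> - m / 4" using m by simp
    finally have "measure_pmf.prob ?G {E. - (m / 4) \<le> (- 1) * real (degree E v)} \<le> exp (- m / 4)" by simp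
    with up show ?thesis
      using measure_Un_le[of "{E. 3 * m \<le> 1 * real (degree E v)}" ?G
          "{E. - (m / 4) \<le> (- 1) * real (degree E v)}"] by simp
  qed
  then have "(\<Sum>v<n. measure_pmf.prob ?G (?B v)) \<le> (\<Sum>v<n. 2 * exp (- m / 4))"
    by (intro sum_mono) auto
  moreover have "measure_pmf.prob ?G (\<Union>v<n. ?B v) \<le> (\<Sum>v<n. measure_pmf.prob ?G (?B v))"
    by (intro measure_pmf.finite_measure_subadditive_finite) auto
  moreover have "measure_pmf.prob ?G (- (\<Union>v<n. ?B v)) = 1 - measure_pmf.prob ?G (\<Union>v<n. ?B v)"
    using measure_pmf.prob_compl[of "\<Union>v<n. ?B v" ?G] by (simp add: Compl_eq_Diff_UNIV)
  moreover have "- (\<Union>v<n. ?B v) = {E. \<forall>v<n. m / 4 < degree E v \<and> degree E v < 3 * m}"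
    by (auto simp: not_le)
  ultimately show ?thesis by (simp add: mult_ac)
qed

section \<open>Colouring a graph with concentrated degrees\<close>

lemma degree_le_max_degree: "finite V \<Longrightarrow> v \<in> V \<Longrightarrow> degree E v \<le> max_degree V E"
  unfolding max_degree_def by (intro Max_ge) auto

lemma ln_le_two_sqrt:
  assumes "x > 0" shows "ln x \<le> 2 * sqrt x"
proof -
  have "ln x = 2 * ln (sqrt x)" using assms by (simp add: ln_sqrt)
  also have "ln (sqrt x) \<le> sqrt x" using assms ln_le_minus_one[of "sqrt x"] by simp
  finally show ?thesis by simp
qed

text \<open>Degrees below \<open>3 * m\<close> and \<open>d \<ge> m / 8\<close> give the ratio
  \<open>r = 24\<close>, hence the exponent \<open>4 * 24 = 96\<close> in \<kappa>.\<close>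

lemma chi_pOCF_le_concentrated:
  fixes m :: real and n :: nat
  defines "\<kappa> \<equiv> exp (- 96 :: real) / 16"
  assumes E: "E \<subseteq> nsets {..<n} 2" and n: "n \<ge> 3"
    and deg: "\<And>v. v < n \<Longrightarrow> m / 4 < degree E v" "\<And>v. v < n \<Longrightarrow> degree E v < 3 * m"
    and m: "3 / \<kappa> * ln n + 3 \<le> m / 8"
  shows "real (chi_pOCF E) \<le> max_degree {..<n} E + (3 / \<kappa> * ln n + 2)"
proof -
  \<comment> \<open>Chosen so that \<open>(1 - \<kappa>) ^ L \<le> 1 / n^3\<close>, which beats the
    at most \<open>n^2\<close> edges.\<close>
  define L where "L = nat \<lceil>3 / \<kappa> * ln n\<rceil>"
  \<comment> \<open>The minimum degree \<open>m / 4\<close> is shared between \<open>d\<close> and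
    \<open>L\<close>, about \<open>m / 8\<close> each; the summand 3 in the assumption absorbs both
    roundings.\<close>
  define d where "d = nat \<lceil>m / 8\<rceil>"
  have \<kappa>: "0 < \<kappa>" "\<kappa> \<le> 1"
    using order_trans[of "exp (- 96 :: real)" 1 16] by (simp_all add: \<kappa>_def)
  have pos: "0 \<le> 3 / \<kappa> * ln n" using n \<kappa> by simp
  have L: "3 / \<kappa> * ln n \<le> L" "L \<le> 3 / \<kappa> * ln n + 1"
    unfolding L_def using pos by (auto simp: of_nat_nat)
  have d: "m / 8 \<le> d" "d \<le> m / 8 + 1"
    unfolding d_def using pos m by (auto simp: of_nat_nat)
  have "(1 - \<kappa>) ^ L * card E < 1"
  proof -
    have "(1 - \<kappa>) ^ L \<le> exp (- \<kappa>) ^ L"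
      using \<kappa> exp_ge_add_one_self[of "- \<kappa>"] by (intro power_mono) auto
    also have "\<dots> = exp (- (\<kappa> * L))" by (simp flip: exp_of_nat_mult add: mult.commute)
    also have "\<dots> \<le> exp (- (3 * ln n))"
      using L(1) \<kappa> by (simp add: field_simps)
    also have "\<dots> = 1 / real n ^ 3"
      using n exp_of_nat_mult[of 3 "ln (real n)"] by (simp add: exp_minus inverse_eq_divide)
    finally have *: "(1 - \<kappa>) ^ L \<le> 1 / real n ^ 3" .
    have "card E \<le> card (nsets {..<n} 2)" using E by (intro card_mono) (auto simp: finite_imp_finite_nsets)
    also have "\<dots> = n choose 2" by (simp add: card_nsets)
    also have "\<dots> \<le> n ^ 2" using n by (intro binomial_le_pow) auto
    finally have "real (card E) \<le> real n ^ 2" by (simp flip: of_nat_power)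
    then have "(1 - \<kappa>) ^ L * card E \<le> 1 / real n ^ 3 * real n ^ 2"
      using * by (intro mult_mono) auto
    also have "\<dots> < 1" using n by (simp add: power2_eq_square power3_eq_cube)
    finally show ?thesis .
  qed
  then have "chi_pOCF E \<le> max_degree {..<n} E + 1 + L"
  proof (intro chi_pOCF_le_near_regular[where V = "{..<n}" and d = d and r = 24])
    show "\<forall>x\<in>{..<n}. d + L \<le> degree E x \<and> degree E x \<le> 24 * d"
    proof (intro ballI conjI)
      fix x assume "x \<in> {..<n}"
      then have "m / 4 < degree E x" "degree E x < 3 * m" using deg by auto
      then show "d + L \<le> degree E x" "degree E x \<le> 24 * d" using d L m by linarith+
    qed
    show "2 \<le> d" using d pos m by linarith
  qed (use E in \<open>auto simp: \<kappa>_def intro: degree_le_max_degree\<close>)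
  then show ?thesis using L(2) by linarith
qed


section \<open>The asymptotic bound\<close>

theorem theorem16:
  fixes \<epsilon> :: real
  assumes "0 < \<epsilon>" and "\<epsilon> < 1"
  shows "\<exists>C::real. C > 0 \<and>
    (\<forall>p :: nat \<Rightarrow> real.
      (\<forall>n. 0 \<le> p n \<and> p n \<le> 1) \<longrightarrow>
      (\<lambda>n. real n powr (- \<epsilon>)) \<in> o(p) \<longrightarrow>
      (\<exists>\<eta> :: nat \<Rightarrow> real. \<eta> \<longlonglongrightarrow> 0 \<and>
        asymptotically_almost_surely (\<lambda>n. binomial_random_graph n (p n))
          (\<lambda>n E. let \<Delta> = real (max_degree {..<n} E) in
            real (chi_pOCF E) \<le> \<Delta> + C * ln \<Delta> \<and>
            \<Delta> + C * ln \<Delta> \<le> (1 + \<eta> n) * \<Delta>)))"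
proof -
  define \<delta> where "\<delta> = 1 - \<epsilon>"
  define K where "K = 3 / (exp (- 96 :: real) / 16)"
  \<comment> \<open>Fixed by \<epsilon> alone: \<open>K + 2\<close> absorbs the additive 2 into
    \<open>ln n\<close>, and \<open>2 / \<delta>\<close> passes from \<open>ln n\<close> to
    \<open>ln (D n)\<close>.\<close>
  define C where "C = 2 * (K + 2) / \<delta>"
  \<comment> \<open>A deterministic lower bound for the maximum degree:
    \<open>4 * D n \<le> m\<close> follows from \<open>n - 1 \<ge> n / 2\<close> and
    \<open>p n \<ge> n powr (- \<epsilon>)\<close>.\<close>
  define D where "D n = real n powr \<delta> / 8" for n :: nat
  \<comment> \<open>From \<open>ln \<Delta> \<le> 2 * sqrt \<Delta>\<close>, with \<open>D n\<close>
    in place of \<Delta> so that the error term does not depend on the random graph.\<close>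
  define \<eta> where "\<eta> n = 2 * C / sqrt (D n)" for n
  have \<delta>: "\<delta> > 0" and K: "K > 0" using assms by (auto simp: \<delta>_def K_def)
  then have C: "C > 0" by (simp add: C_def)
  have large: "\<forall>\<^sub>F n in sequentially. n \<ge> 3 \<and> K * ln (real n) + 3 \<le> D n / 2 \<and>
      \<delta> / 2 * ln (real n) \<le> ln (D n)"
  proof (intro eventually_conj)
    show "\<forall>\<^sub>F n in sequentially. n \<ge> (3 :: nat)" by (rule eventually_ge_at_top)
    show "\<forall>\<^sub>F n in sequentially. K * ln (real n) + 3 \<le> D n / 2"
      unfolding D_def using \<delta> K by real_asymp
    show "\<forall>\<^sub>F n in sequentially. \<delta> / 2 * ln (real n) \<le> ln (D n)"
      unfolding D_def using \<delta> by real_asymp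
  qed
  have \<eta>: "\<eta> \<longlonglongrightarrow> 0" unfolding \<eta>_def D_def using \<delta> by real_asymp
  have aas: "asymptotically_almost_surely (\<lambda>n. binomial_random_graph n (p n))
      (\<lambda>n E. let \<Delta> = real (max_degree {..<n} E) in
         real (chi_pOCF E) \<le> \<Delta> + C * ln \<Delta> \<and> \<Delta> + C * ln \<Delta> \<le> (1 + \<eta> n) * \<Delta>)"
    if p: "\<forall>n. 0 \<le> p n \<and> p n \<le> 1" and "(\<lambda>n. real n powr (- \<epsilon>)) \<in> o(p)" for p
  proof -
    let ?G = "\<lambda>n. binomial_random_graph n (p n)"
    let ?P = "\<lambda>n E. let \<Delta> = real (max_degree {..<n} E) in
         real (chi_pOCF E) \<le> \<Delta> + C * ln \<Delta> \<and> \<Delta> + C * ln \<Delta> \<le> (1 + \<eta> n) * \<Delta>"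
    have "\<forall>\<^sub>F n in sequentially. real n powr (- \<epsilon>) \<le> p n"
      using landau_o.smallD[OF that(2), of 1] p by simp
    then have "\<forall>\<^sub>F n in sequentially.
        1 - 2 * real n * exp (- D n) \<le> measure_pmf.prob (?G n) {E. ?P n E}"
      using large
    proof eventually_elim
      case (elim n)
      define m where "m = real (n - 1) * p n"
      have Dm: "4 * D n \<le> m"
      proof -
        have "4 * D n = real n / 2 * real n powr (- \<epsilon>)"
          using elim by (simp add: D_def \<delta>_def powr_diff powr_minus field_simps)
        also have "\<dots> \<le> real (n - 1) * p n" using elim by (intro mult_mono) auto
        finally show ?thesis by (simp add: m_def)
      qed
      have D: "D n > 0" using elim K by (simp add: D_def)
      have P: "?P n E" if E: "E \<subseteq> nsets {..<n} 2"
        and deg: "\<forall>v<n. m / 4 < degree E v \<and> degree E v < 3 * m" for E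
      proof -
        define \<Delta> where "\<Delta> = real (max_degree {..<n} E)"
        have "m / 4 < degree E 0" using deg elim by auto
        also have "degree E 0 \<le> max_degree {..<n} E" using elim by (intro degree_le_max_degree) auto
        finally have \<Delta>: "D n \<le> \<Delta>" using Dm by (simp add: \<Delta>_def)
        have "real (chi_pOCF E) \<le> \<Delta> + (K * ln n + 2)"
          unfolding \<Delta>_def K_def
        proof (rule chi_pOCF_le_concentrated[OF E])
          show "3 / (exp (- 96) / 16) * ln n + 3 \<le> m / 8" using elim Dm unfolding K_def by linarith
        qed (use deg elim in auto)
        also have "K * ln n + 2 \<le> C * ln \<Delta>"
        proof -
          \<comment> \<open>Here \<open>n \<ge> 3\<close> enters, through
            \<open>exp 1 \<le> 3\<close>.\<close>
          have "1 \<le> ln (real n)"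
            using elim exp_le ln_ge_iff[of "real n" 1] by auto
          then have "K * ln n + 2 \<le> (K + 2) * ln n" by (simp add: algebra_simps)
          also have "\<dots> = C * (\<delta> / 2 * ln n)" using \<delta> by (simp add: C_def)
          also have "\<dots> \<le> C * ln (D n)" using elim C by (intro mult_left_mono) auto
          also have "\<dots> \<le> C * ln \<Delta>" using \<Delta> D C by (intro mult_left_mono) auto
          finally show ?thesis .
        qed
        finally have chi: "real (chi_pOCF E) \<le> \<Delta> + C * ln \<Delta>" by simp
        have "C * ln \<Delta> \<le> C * (2 * sqrt \<Delta>)"
          using ln_le_two_sqrt[of \<Delta>] \<Delta> D C by (intro mult_left_mono) auto
        also have "\<dots> = 2 * C / sqrt \<Delta> * \<Delta>"
          using \<Delta> D by (simp add: field_simps flip: real_sqrt_mult)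
        also have "\<dots> \<le> \<eta> n * \<Delta>"
          unfolding \<eta>_def using \<Delta> D C by (intro mult_right_mono divide_left_mono) auto
        finally have "\<Delta> + C * ln \<Delta> \<le> (1 + \<eta> n) * \<Delta>" by (simp add: algebra_simps)
        with chi show ?thesis by (simp add: Let_def \<Delta>_def)
      qed
      have "1 - 2 * real n * exp (- D n) \<le> 1 - 2 * real n * exp (- m / 4)"
        using Dm by (intro diff_left_mono mult_left_mono) auto
      also have "\<dots> \<le> measure_pmf.prob (?G n) {E. \<forall>v<n. m / 4 < degree E v \<and> degree E v < 3 * m}"
        unfolding m_def using p by (intro prob_degrees_concentrated) auto
      \<comment> \<open>\<open>P\<close> applies to subsets of \<open>nsets {..<n} 2\<close>, so the
        inclusion of events is established on the support of the distribution.\<close>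
      also have "\<dots> \<le> measure_pmf.prob (?G n) {E. ?P n E}"
        using P set_pmf_binomial_random_graph
        by (intro measure_pmf.finite_measure_mono_AE) (auto intro!: AE_pmfI)
      finally show ?case .
    qed
    moreover have "\<forall>\<^sub>F n in sequentially. measure_pmf.prob (?G n) {E. ?P n E} \<le> 1"
      by (intro always_eventually allI measure_pmf.prob_le_1)
    \<comment> \<open>The power of \<open>n\<close> in the exponent outweighs the factor
      \<open>n\<close> of the union bound.\<close>
    moreover have "(\<lambda>n. 1 - 2 * real n * exp (- D n)) \<longlonglongrightarrow> 1"
      unfolding D_def using \<delta> by real_asymp
    ultimately show ?thesis
      unfolding asymptotically_almost_surely_def by (rule tendsto_sandwich) (rule tendsto_const)
  qed
  show ?thesis
  proof (intro exI[of _ C] conjI allI impI)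
    show "C > 0" by (rule C)
  next
    fix p :: "nat \<Rightarrow> real"
    assume "\<forall>n. 0 \<le> p n \<and> p n \<le> 1" "(\<lambda>n. real n powr (- \<epsilon>)) \<in> o(p)"
    from \<eta> aas[OF this] show "\<exists>\<eta>. \<eta> \<longlonglongrightarrow> 0 \<and>
        asymptotically_almost_surely (\<lambda>n. binomial_random_graph n (p n))
          (\<lambda>n E. let \<Delta> = real (max_degree {..<n} E) in
            real (chi_pOCF E) \<le> \<Delta> + C * ln \<Delta> \<and> \<Delta> + C * ln \<Delta> \<le> (1 + \<eta> n) * \<Delta>)"
      by (intro exI[of _ \<eta>] conjI)
  qed
qed

end
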